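(* Let $k\ge 1$ and $n\ge 4$ be integers. There exists a universal cycle for the set of all $n$-letter words over the alphabet $[k]=\{1,\dots,k\}$ in which at least one letter is repeated (equivalently, non-injective functions $\{1,\dots,n\}\to\{1,\dots,k\}$).
   Context: For a set $\mathcal{C}$ of $n$-letter words over an alphabet, a universal cycle (U-cycle) for $\mathcal{C}$ is a cyclic sequence $x_1x_2\dots x_N$ with $N=|\mathcal{C}|$ such that the $N$ words $x_ix_{i+1}\dots x_{i+n-1}$ ($1\le i\le N$, indices taken modulo $N$) are exactly the words of $\mathcal{C}$, each occurring exactly once. *)

theory Defs
  imports Main
begin

text \<open>
  A cyclic sequence is represented by a list, read with indices modulo its length;
  positions are counted from \<open>0\<close>.  Windows may be longer than the sequence, in which
  case they wrap around repeatedly.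
\<close>

definition cyclic_window :: "'a list \<Rightarrow> nat \<Rightarrow> nat \<Rightarrow> 'a list" where
  "cyclic_window xs n i = map (\<lambda>j. xs ! ((i + j) mod length xs)) [0..<n]"

definition universal_cycle :: "nat \<Rightarrow> 'a list set \<Rightarrow> 'a list \<Rightarrow> bool" where
  "universal_cycle n C xs \<longleftrightarrow>
     length xs = card C \<and> bij_betw (cyclic_window xs n) {..<length xs} C"

definition words_with_repetition :: "nat \<Rightarrow> nat \<Rightarrow> nat list set" where
  "words_with_repetition n k = {w. length w = n \<and> set w \<subseteq> {1..k} \<and> \<not> distinct w}"

end

theory Submission
  imports Defs "Graph_Theory.Euler"
begin

text \<open>
  The words with a repeated letter are the arcs of a digraph on the words of length \<open>n - 1\<close>,
  each word leading from its prefix to its suffix; a universal cycle is an Euler tour of this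
  digraph.  Rotating words matches the arcs into a vertex with those out of it, so in-degrees
  and out-degrees agree.  For connectedness, a vertex is linked to each of its rotations since
  \<open>v\<close> followed by its own first letter is an arc.  Modulo rotation, an arc replaces one letter
  of a vertex, and such a replacement is allowed in particular when the new letter already
  occurs.  Hence every vertex is linked to a constant word, and as \<open>n - 1 \<ge> 3\<close> one letter of
  a constant word can be changed to any other letter and then be spread over the whole word.
\<close>

definition overlap_digraph :: "'a set \<Rightarrow> nat \<Rightarrow> 'a list set \<Rightarrow> ('a list, 'a list) pre_digraph" where
  "overlap_digraph A n C =
     \<lparr>verts = {v. Suc (length v) = n \<and> set v \<subseteq> A}, arcs = C, tail = butlast, head = tl\<rparr>"

lemma overlap_digraph_simps [simp]:
  "verts (overlap_digraph A n C) = {v. Suc (length v) = n \<and> set v \<subseteq> A}"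
  "arcs (overlap_digraph A n C) = C"
  "tail (overlap_digraph A n C) = butlast"
  "head (overlap_digraph A n C) = tl"
  by (simp_all add: overlap_digraph_def)

lemma (in pre_digraph) cas_nth_Suc:
  assumes "cas u p v" "Suc i < length p"
  shows "head G (p ! i) = tail G (p ! Suc i)"
  using assms
proof (induction p arbitrary: u i)
  case Nil
  then show ?case by simp
next
  case (Cons e p)
  then show ?case by (cases i; cases p) auto
qed

lemma (in pre_digraph) cas_append:
  "cas u p v \<Longrightarrow> cas v q w \<Longrightarrow> cas u (p @ q) w"
  by (induction p arbitrary: u) auto

text \<open>Going round the closed walk twice is again a walk, and in \<open>p @ p\<close> the
  return from the last arc to the first is an ordinary consecutive pair.\<close>

lemma (in pre_digraph) closed_cas_nth:
  assumes "cas u p u" "i < length p"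
  shows "head G (p ! i) = tail G (p ! (Suc i mod length p))"
proof -
  have "cas u (p @ p) u"
    using cas_append[OF assms(1) assms(1)] .
  then have "head G ((p @ p) ! i) = tail G ((p @ p) ! Suc i)"
    using assms(2) by (rule_tac cas_nth_Suc) auto
  with assms(2) show ?thesis
    by (cases "Suc i = length p") (auto simp: nth_append)
qed

text \<open>Consecutive words of the tour overlap in all but one letter, so their first letters
  determine them: the window of \<open>map hd p\<close> at \<open>i\<close> is \<open>p ! i\<close>
  itself.\<close>

lemma universal_cycle_if_euler_trail:
  assumes trail: "pre_digraph.euler_trail (overlap_digraph A n C) u p u"
    and len: "\<And>w. w \<in> C \<Longrightarrow> length w = n" and "0 < n"
  shows "universal_cycle n C (map hd p)"
proof -
  interpret pre_digraph "overlap_digraph A n C" .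
  have cas: "cas u p u" and dist: "distinct p" and set: "set p = C"
    using trail by (auto simp: euler_trail_def trail_def awalk_def)
  have length_nth: "length (p ! i) = n" if "i < length p" for i
    using that set len by auto
  \<comment> \<open>Passing to the next arc lowers the position \<open>j\<close> by one, hence the
    induction on \<open>j\<close> with \<open>i\<close> arbitrary. The indices wrap around, so the
    tour may be shorter than \<open>n\<close>.\<close>
  have letter: "p ! i ! j = hd (p ! ((i + j) mod length p))"
    if "i < length p" "j < n" for i j
    using that
  proof (induction j arbitrary: i)
    case 0
    then have "p ! i \<noteq> []" using length_nth by fastforce
    with 0 show ?case by (simp add: hd_conv_nth)
  next
    case (Suc j)
    let ?i = "Suc i mod length p"
    have i: "?i < length p" using Suc.prems by (metis mod_less_divisor not_less_zero gr0I)
    have "p ! i ! Suc j = tl (p ! i) ! j"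
      using Suc.prems length_nth by (simp add: nth_tl)
    also have "\<dots> = butlast (p ! ?i) ! j"
      using closed_cas_nth[OF cas] Suc.prems by simp
    also have "\<dots> = p ! ?i ! j"
      using Suc.prems length_nth[OF i] by (simp add: nth_butlast)
    also have "\<dots> = hd (p ! ((?i + j) mod length p))"
      using Suc.IH[OF i] Suc.prems by simp
    finally show ?case by (simp add: mod_add_left_eq)
  qed
  have "cyclic_window (map hd p) n i = p ! i" if "i < length p" for i
  proof (rule nth_equalityI)
    have "(i + j) mod length p < length p" for j
      using that by (intro mod_less_divisor) auto
    then show "cyclic_window (map hd p) n i ! j = p ! i ! j"
      if "j < length (cyclic_window (map hd p) n i)" for j
      using \<open>i < length p\<close> that letter by (simp add: cyclic_window_def)
  qed (use that length_nth in \<open>simp add: cyclic_window_def\<close>)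
  moreover have "bij_betw ((!) p) {..<length p} C"
    using dist set by (simp add: bij_betw_nth)
  ultimately have "bij_betw (cyclic_window (map hd p) n) {..<length p} C"
    using bij_betw_cong[of "{..<length p}"] by (metis lessThan_iff)
  then show ?thesis
    using dist set by (auto simp: universal_cycle_def distinct_card)
qed

definition repetitive_words :: "'a set \<Rightarrow> nat \<Rightarrow> 'a list set" where
  "repetitive_words A n = {w. length w = n \<and> set w \<subseteq> A \<and> \<not> distinct w}"

abbreviation repetition_digraph :: "'a set \<Rightarrow> nat \<Rightarrow> ('a list, 'a list) pre_digraph" where
  "repetition_digraph A n \<equiv> overlap_digraph A n (repetitive_words A n)"

lemma fin_digraph_repetition_digraph:
  assumes "finite A"
  shows "fin_digraph (repetition_digraph A n)"
proof
  have fin: "finite {w. set w \<subseteq> A \<and> length w = k}" for k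
    using assms by (rule finite_lists_length_eq)
  show "finite (verts (repetition_digraph A n))"
    by (rule finite_subset[OF _ fin[of "n - 1"]]) auto
  show "finite (arcs (repetition_digraph A n))"
    by (rule finite_subset[OF _ fin[of n]]) (auto simp: repetitive_words_def)
next
  fix w assume "w \<in> arcs (repetition_digraph A n)"
  then have w: "length w = n" "set w \<subseteq> A" "w \<noteq> []"
    by (auto simp: repetitive_words_def)
  then show "tail (repetition_digraph A n) w \<in> verts (repetition_digraph A n)"
    by (auto dest: in_set_butlastD)
  show "head (repetition_digraph A n) w \<in> verts (repetition_digraph A n)"
    using w by (auto dest: list.set_sel(2))
qed

text \<open>Arcs into \<open>v\<close> have the form \<open>a # v\<close> and arcs out of it the
  form \<open>v @ [a]\<close>; \<open>rotate1\<close> turns one into the other and keeps the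
  multiplicities of letters.\<close>

lemma repetition_digraph_balanced:
  "in_degree (repetition_digraph A n) v = out_degree (repetition_digraph A n) v"
proof -
  let ?G = "repetition_digraph A n"
  have "bij_betw rotate1 (in_arcs ?G v) (out_arcs ?G v)"
  proof (rule bij_betw_imageI)
    show "inj_on rotate1 (in_arcs ?G v)"
      by (meson inj_on_subset inj_rotate1 subset_UNIV)
    show "rotate1 ` in_arcs ?G v = out_arcs ?G v"
    proof (intro equalityI subsetI)
      fix w assume "w \<in> rotate1 ` in_arcs ?G v"
      then obtain x where x: "x \<in> in_arcs ?G v" "w = rotate1 x" by blast
      moreover from x have "x \<noteq> []" by (auto simp: in_arcs_def repetitive_words_def)
      ultimately show "w \<in> out_arcs ?G v"
        by (cases x) (auto simp: in_arcs_def out_arcs_def repetitive_words_def)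
    next
      fix w assume w: "w \<in> out_arcs ?G v"
      then have "w \<noteq> []" by (auto simp: out_arcs_def repetitive_words_def)
      then obtain a x where a: "w = x @ [a]" by (metis rev_exhaust)
      with w have "a # x \<in> in_arcs ?G v"
        by (auto simp: in_arcs_def out_arcs_def repetitive_words_def)
      with a show "w \<in> rotate1 ` in_arcs ?G v" by (metis image_eqI rotate1.simps(2))
    qed
  qed
  then show ?thesis
    by (simp add: in_degree_def out_degree_def bij_betw_same_card)
qed

text \<open>Reachability with arcs usable in both directions, in the form in which
  \<open>connected_conv\<close> expresses connectedness.\<close>

definition linked :: "'a set \<Rightarrow> nat \<Rightarrow> 'a list \<Rightarrow> 'a list \<Rightarrow> bool" where
  "linked A n u v \<longleftrightarrow>
     (u, v) \<in> rtrancl_on (verts (repetition_digraph A n)) ((arcs_ends (repetition_digraph A n))\<^sup>s)"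

lemma linked_refl: "Suc (length v) = n \<Longrightarrow> set v \<subseteq> A \<Longrightarrow> linked A n v v"
  by (simp add: linked_def)

lemma linked_trans [trans]: "linked A n u v \<Longrightarrow> linked A n v w \<Longrightarrow> linked A n u w"
  unfolding linked_def by (rule rtrancl_on_trans)

lemma linked_sym:
  assumes "linked A n u v"
  shows "linked A n v u"
proof -
  have "sym (R\<^sup>s)" for R :: "'a list rel"
    by (auto simp: sym_def symcl_def)
  then show ?thesis
    using assms unfolding linked_def by (meson rtrancl_on_sym symE)
qed

lemma linked_arc:
  assumes "w \<in> repetitive_words A n"
  shows "linked A n (butlast w) (tl w)"
proof -
  let ?G = "repetition_digraph A n"
  have w: "length w = n" "set w \<subseteq> A" "w \<noteq> []"
    using assms by (auto simp: repetitive_words_def)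
  then have verts: "butlast w \<in> verts ?G" "tl w \<in> verts ?G"
    by (auto dest: in_set_butlastD list.set_sel(2))
  have "(butlast w, tl w) \<in> (arcs_ends ?G)\<^sup>s"
    using assms by (auto simp: symcl_def arcs_ends_conv)
  with verts show ?thesis unfolding linked_def by (meson rtrancl_on.intros)
qed

lemma linked_Cons_snoc:
  assumes "\<not> distinct (a # u @ [b])" "set (a # u @ [b]) \<subseteq> A" "length u + 2 = n"
  shows "linked A n (a # u) (u @ [b])"
  using linked_arc[of "a # u @ [b]" A n] assms
  by (auto simp: repetitive_words_def butlast_append)

lemma linked_rotate:
  assumes "length (u @ v) + 1 = n" "set (u @ v) \<subseteq> A"
  shows "linked A n (u @ v) (v @ u)"
  using assms
proof (induction u arbitrary: v)
  case Nil
  then show ?case by (auto intro: linked_refl)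
next
  case (Cons a u)
  \<comment> \<open>The arc used is \<open>a # (u @ v) @ [a]\<close>, which repeats \<open>a\<close>
    whatever \<open>u\<close> and \<open>v\<close> are.\<close>
  have "linked A n (a # (u @ v)) ((u @ v) @ [a])"
    using Cons.prems by (intro linked_Cons_snoc) auto
  moreover have "linked A n (u @ (v @ [a])) ((v @ [a]) @ u)"
    using Cons.prems by (intro Cons.IH) auto
  ultimately show ?case by (auto intro: linked_trans)
qed

text \<open>Rotate until \<open>a\<close> stands in front, drop it while appending \<open>b\<close>,
  and rotate back. The first hypothesis makes the arc \<open>a # (v @ u) @ [b]\<close> a word with a
  repetition.\<close>

lemma linked_replace:
  assumes "\<not> distinct (u @ v) \<or> b \<in> set (u @ a # v)"
    and "length (u @ v) + 2 = n" "set (u @ a # v) \<subseteq> A" "b \<in> A"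
  shows "linked A n (u @ a # v) (u @ b # v)"
proof -
  have "linked A n (u @ a # v) (a # v @ u)"
    using assms linked_rotate[of u "a # v"] by auto
  also have "linked A n (a # v @ u) ((v @ u) @ [b])"
    using assms by (intro linked_Cons_snoc) auto
  also have "linked A n ((v @ u) @ [b]) (u @ b # v)"
    using assms linked_rotate[of v "u @ [b]"] by auto
  finally show ?thesis .
qed

text \<open>The prefix \<open>u\<close> already contains \<open>a\<close>, so
  \<open>linked_replace\<close> may overwrite the letters after it one by one, each joining the
  prefix.\<close>

lemma linked_fill:
  assumes "a \<in> set u" "length (u @ v) + 1 = n" "set (u @ v) \<subseteq> A"
  shows "linked A n (u @ v) (u @ replicate (length v) a)"
  using assms
proof (induction v arbitrary: u)
  case Nil
  then show ?case by (auto intro: linked_refl)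
next
  case (Cons c v)
  have "linked A n (u @ c # v) (u @ a # v)"
    using Cons.prems by (intro linked_replace) auto
  moreover have "linked A n ((u @ [a]) @ v) ((u @ [a]) @ replicate (length v) a)"
    using Cons.prems by (intro Cons.IH) auto
  ultimately show ?case by (auto intro: linked_trans)
qed

lemma linked_constant:
  assumes "n \<ge> 4" "Suc (length v) = n" "set v \<subseteq> A" "b \<in> A"
  shows "linked A n v (replicate (n - 1) b)"
proof -
  obtain m where n: "n = m + 4" using assms(1) by (metis add.commute le_Suc_ex)
  obtain a w where v: "v = a # w" using assms n by (cases v) auto
  have w: "length w = Suc (Suc m)" using assms v n by simp
  have "linked A n ([a] @ w) ([a] @ replicate (length w) a)"
    using assms v by (intro linked_fill) auto
  then have "linked A n v ([] @ a # replicate (length w) a)" using v by simp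
  \<comment> \<open>The letter \<open>b\<close> may be new here, so the repetition has to come from
    the remaining copies of \<open>a\<close>. There are \<open>m + 2\<close> of them, hence at least
    two; this is where \<open>n \<ge> 4\<close> enters.\<close>
  also have "linked A n ([] @ a # replicate (length w) a) ([] @ b # replicate (length w) a)"
    using assms v w by (intro linked_replace) auto
  also have "linked A n ([] @ b # replicate (length w) a) ([b] @ replicate (length w) b)"
    using assms v linked_fill[of b "[b]" "replicate (length w) a" n A] w
    by (auto simp: set_replicate_conv_if split: if_splits)
  finally show ?thesis using n w by (simp add: numeral_3_eq_3)
qed

lemma connected_repetition_digraph:
  assumes "n \<ge> 4" "finite A" "A \<noteq> {}"
  shows "connected (repetition_digraph A n)"
proof -
  interpret fin_digraph "repetition_digraph A n"
    using assms(2) by (rule fin_digraph_repetition_digraph)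
  obtain b where b: "b \<in> A" using assms by blast
  have "replicate (n - 1) b \<in> verts (repetition_digraph A n)"
    using assms b by auto
  \<comment> \<open>The constant word of \<open>b\<close> serves as a hub to which both
    \<open>u\<close> and \<open>v\<close> are linked.\<close>
  moreover have "linked A n u v"
    if "u \<in> verts (repetition_digraph A n)" "v \<in> verts (repetition_digraph A n)" for u v
    using that assms(1) b linked_constant[of n u A b] linked_constant[of n v A b]
    by (auto intro: linked_trans linked_sym)
  ultimately show ?thesis unfolding connected_conv linked_def by blast
qed

theorem theorem5:
  fixes k n :: nat
  assumes "k \<ge> 1" and "n \<ge> 4"
  shows "\<exists>xs. universal_cycle n (words_with_repetition n k) xs"
proof -
  let ?G = "repetition_digraph {1..k} n"
  interpret fin_digraph ?G by (rule fin_digraph_repetition_digraph) simp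
  \<comment> \<open>Connectedness includes having a vertex; \<open>k \<ge> 1\<close> supplies a
    letter to build one.\<close>
  have "connected ?G"
    using assms by (intro connected_repetition_digraph) auto
  then obtain u p where "euler_trail u p u"
    using closed_euler1 repetition_digraph_balanced by blast
  then have "universal_cycle n (repetitive_words {1..k} n) (map hd p)"
    using assms by (intro universal_cycle_if_euler_trail) (auto simp: repetitive_words_def)
  then show ?thesis
    by (auto simp: words_with_repetition_def repetitive_words_def)
qed

end
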